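(* Let $G$ be a finite simple connected graph with $n=n(G)$ vertices and $m(G)$ edges, and suppose $\mathrm{gp}^-(G)=k\ge 2$ and $n\ge 2k-1$. Then $m(G)\le \binom{n}{2}-k+1$. Moreover, the unique graph of order $n$ attaining this bound is the graph obtained from the complete graph $K_n$ by deleting $k-1$ edges incident to a fixed vertex.
   Context: A set $S$ of vertices of a connected graph is a general position set if no shortest path contains three or more vertices of $S$; it is maximal if not properly contained in another general position set; $\mathrm{gp}^-(G)$ is the number of vertices in a smallest maximal general position set. *)

theory Defs
  imports "Graph_Theory.Graph_Theory"
begin

text \<open>
  Finite simple graphs are the \<^locale>\<open>pair_graph\<close>s of the library: finite, loopless, without
  parallel arcs, and symmetric, so that every undirected edge \<open>{u, v}\<close> is present as the two arcs
  \<open>(u, v)\<close> and \<open>(v, u)\<close>.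
\<close>

definition num_verts :: "'a pair_pre_digraph \<Rightarrow> nat" where
  "num_verts G = card (pverts G)"

definition edges :: "'a pair_pre_digraph \<Rightarrow> 'a set set" where
  "edges G = {{u, v} | u v. (u, v) \<in> parcs G}"

definition num_edges :: "'a pair_pre_digraph \<Rightarrow> nat" where
  "num_edges G = card (edges G)"

definition shortest_vpath :: "'a vwalk \<Rightarrow> 'a pair_pre_digraph \<Rightarrow> bool" where
  "shortest_vpath p G \<longleftrightarrow> vpath p G \<and>
     (\<forall>q. vpath q G \<and> hd q = hd p \<and> last q = last p \<longrightarrow> vwalk_length p \<le> vwalk_length q)"

definition general_position :: "'a pair_pre_digraph \<Rightarrow> 'a set \<Rightarrow> bool" where
  "general_position G S \<longleftrightarrow> S \<subseteq> pverts G \<and>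
     (\<forall>p. shortest_vpath p G \<longrightarrow> \<not> 3 \<le> card (S \<inter> set p))"

definition maximal_general_position :: "'a pair_pre_digraph \<Rightarrow> 'a set \<Rightarrow> bool" where
  "maximal_general_position G S \<longleftrightarrow> general_position G S \<and>
     \<not> (\<exists>T. general_position G T \<and> S \<subset> T)"

definition gp_minus :: "'a pair_pre_digraph \<Rightarrow> nat" where
  "gp_minus G = Min (card ` {S. maximal_general_position G S})"

definition complete_graph :: "'a set \<Rightarrow> 'a pair_pre_digraph" where
  "complete_graph V = \<lparr> pverts = V, parcs = {(u, v). u \<in> V \<and> v \<in> V \<and> u \<noteq> v} \<rparr>"

definition delete_edges :: "'a pair_pre_digraph \<Rightarrow> 'a set set \<Rightarrow> 'a pair_pre_digraph" where
  "delete_edges G F = \<lparr> pverts = pverts G, parcs = {(u, v) \<in> parcs G. {u, v} \<notin> F} \<rparr>"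

text \<open>
  The representative, on the vertices \<open>0, \<dots>, n - 1\<close>, of the isomorphism class of the graphs obtained
  from \<open>K\<^sub>n\<close> by deleting \<open>k - 1\<close> edges at one vertex: the vertex is \<open>0\<close>, and the edges to
  \<open>1, \<dots>, k - 1\<close> are deleted. Meaningful for \<open>1 \<le> k \<le> n\<close>.
\<close>

definition extremal_graph :: "nat \<Rightarrow> nat \<Rightarrow> nat pair_pre_digraph" where
  "extremal_graph n k = delete_edges (complete_graph {..<n}) ((\<lambda>i. {0, i}) ` {1..<k})"

end

theory Submission
  imports Defs
begin

text \<open>
  A general position set \<open>S\<close> contains no induced path \<open>x - y - z\<close>. If \<open>S\<close> is maximal and contains a
  non-adjacent pair \<open>u, v\<close>, then every other vertex of \<open>S\<close> is non-adjacent to \<open>u\<close> or to \<open>v\<close>, so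
  \<open>S\<close> spans at least \<open>|S| - 1 \<ge> k - 1\<close> non-edges. In case of equality these are all non-edges, they
  form a double star with centres \<open>u\<close> and \<open>v\<close>, and a double star with leaves at both centres would
  create an induced path inside \<open>S\<close>; hence they form a star. A complete graph has \<open>gp\<^sup>- = n\<close>, which
  \<open>n \<ge> 2 k - 1\<close> excludes.
\<close>

section \<open>Non-edges\<close>

text \<open>The claimed upper bound on \<open>num_edges\<close> amounts to at least
  \<open>k - 1\<close> of these pairs, and the extremal graph is recognised by their shape. Like
  \<open>edges\<close>, they are unordered, so each is counted once.\<close>

definition non_edges :: "'a pair_pre_digraph \<Rightarrow> 'a set set" where
  "non_edges G = {{u, v} | u v. u \<in> pverts G \<and> v \<in> pverts G \<and> u \<noteq> v \<and> (u, v) \<notin> parcs G}"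

lemma (in pair_graph) insert_in_non_edges_iff:
  "{u, v} \<in> non_edges G \<longleftrightarrow> u \<in> pverts G \<and> v \<in> pverts G \<and> u \<noteq> v \<and> (u, v) \<notin> parcs G"
  unfolding non_edges_def by (auto simp: doubleton_eq_iff dest: arcs_symmetric)

lemma (in pair_graph) in_parcs_iff_non_edges:
  "(u, v) \<in> parcs G \<longleftrightarrow> u \<in> pverts G \<and> v \<in> pverts G \<and> u \<noteq> v \<and> {u, v} \<notin> non_edges G"
  using insert_in_non_edges_iff in_arcsD1 in_arcsD2 no_loops' by blast

lemma (in pair_graph) finite_non_edges: "finite (non_edges G)"
  by (rule finite_subset[of _ "Pow (pverts G)"]) (auto simp: non_edges_def)

lemma (in pair_graph) num_edges_plus_card_non_edges:
  "num_edges G + card (non_edges G) = num_verts G choose 2"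
proof -
  have eq: "edges G \<union> non_edges G = {K. K \<subseteq> pverts G \<and> card K = 2}"
  proof (intro equalityI subsetI)
    fix K assume "K \<in> edges G \<union> non_edges G"
    then show "K \<in> {K. K \<subseteq> pverts G \<and> card K = 2}"
      by (auto simp: edges_def non_edges_def card_2_iff doubleton_eq_iff
          dest: in_arcsD1 in_arcsD2 no_loops')
  next
    fix K assume "K \<in> {K. K \<subseteq> pverts G \<and> card K = 2}"
    then obtain x y where "K = {x, y}" "x \<noteq> y" "x \<in> pverts G" "y \<in> pverts G"
      by (auto simp: card_2_iff)
    then show "K \<in> edges G \<union> non_edges G"
      by (cases "(x, y) \<in> parcs G") (auto simp: edges_def insert_in_non_edges_iff)
  qed
  have disj: "edges G \<inter> non_edges G = {}"
    using insert_in_non_edges_iff by (fastforce simp: edges_def)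
  have "finite (edges G)"
    by (rule finite_subset[of _ "Pow (pverts G)"])
      (auto simp: edges_def dest: in_arcsD1 in_arcsD2)
  then have "num_edges G + card (non_edges G) = card (edges G \<union> non_edges G)"
    unfolding num_edges_def using disj finite_non_edges by (simp add: card_Un_disjoint)
  then show ?thesis
    unfolding eq num_verts_def by (simp add: n_subsets)
qed

text \<open>Gives the converse in the equality case: a graph isomorphic to the extremal one attains
  the bound.\<close>

lemma digraph_iso_num_edges:
  fixes G :: "'a pair_pre_digraph" and H :: "'b pair_pre_digraph"
  assumes "digraph_iso G H"
  shows "num_edges G = num_edges H"
proof -
  obtain h where h: "pre_digraph.digraph_isomorphism (with_proj G) h"
    and H: "with_proj H = app_iso h (with_proj G)"
    using assms by (auto simp: digraph_iso_def)
  have wf: "pair_wf_digraph G" and inj: "inj_on (iso_verts h) (pverts G)"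
    using h by (auto simp: pre_digraph.digraph_isomorphism_def wf_digraph_wp_iff)
  have tail: "iso_tail h = fst" and head: "iso_head h = snd"
    and arcs: "parcs H = iso_arcs h ` parcs G"
    using arg_cong[OF H, of tail] arg_cong[OF H, of head] arg_cong[OF H, of arcs] by simp_all
  \<comment> \<open>An isomorphism maps vertices and arcs separately. Since tail and head in the
    image are again \<open>fst\<close> and \<open>snd\<close>, the arc map is forced to act
    componentwise by the vertex map.\<close>
  have arc: "iso_arcs h (u, v) = (iso_verts h u, iso_verts h v)" if "(u, v) \<in> parcs G" for u v
    using h that unfolding pre_digraph.digraph_isomorphism_def by (force simp: tail head prod_eq_iff)
  have "edges H = (image (iso_verts h)) ` edges G"
    unfolding edges_def arcs using arc by (auto simp: image_iff) (metis image_insert image_empty)+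
  moreover have "inj_on (image (iso_verts h)) (edges G)"
    by (rule inj_on_subset[OF inj_on_image_Pow[OF inj]])
      (auto simp: edges_def dest: pair_wf_digraph.wellformed'[OF wf])
  ultimately show ?thesis
    by (simp add: num_edges_def card_image)
qed

section \<open>General position sets and induced paths\<close>

text \<open>In a \<open>pair_graph\<close> this means that \<open>S\<close> induces a disjoint union
  of cliques. It is a local substitute for the condition on all shortest paths: always necessary,
  and sufficient for sets of vertices when some vertex is adjacent to all others.\<close>

definition p3_free :: "'a pair_pre_digraph \<Rightarrow> 'a set \<Rightarrow> bool" where
  "p3_free G S \<longleftrightarrow> (\<forall>x\<in>S. \<forall>y\<in>S. \<forall>z\<in>S.
     x \<noteq> z \<and> (x, y) \<in> parcs G \<and> (y, z) \<in> parcs G \<longrightarrow> (x, z) \<in> parcs G)"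

lemma p3_freeD:
  assumes "p3_free G S" "x \<in> S" "y \<in> S" "z \<in> S"
    and "x \<noteq> z" "(x, y) \<in> parcs G" "(y, z) \<in> parcs G"
  shows "(x, z) \<in> parcs G"
  using assms unfolding p3_free_def by blast

text \<open>If x and z are distinct and non-adjacent, the path x - y - z is itself a shortest path,
  and it has three vertices in \<open>S\<close>.\<close>

lemma (in pair_graph) general_position_imp_p3_free:
  assumes "general_position G S"
  shows "p3_free G S"
  unfolding p3_free_def
proof (intro ballI impI, elim conjE, rule ccontr)
  fix x y z
  assume S: "x \<in> S" "y \<in> S" "z \<in> S" and "x \<noteq> z"
    and arcs: "(x, y) \<in> parcs G" "(y, z) \<in> parcs G" and "(x, z) \<notin> parcs G"
  have distinct: "distinct [x, y, z]"
    using \<open>x \<noteq> z\<close> arcs no_loops' by auto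
  have path: "vpath [x, y, z] (with_proj G)"
    using distinct arcs in_arcsD1 in_arcsD2 by (auto simp: vpath_def vwalk_def)
  have "2 \<le> vwalk_length q" if "vpath q (with_proj G)" "hd q = x" "last q = z" for q
  proof (rule ccontr)
    assume "\<not> 2 \<le> vwalk_length q"
    then have "length q \<le> 2" by simp
    moreover have "q \<noteq> []" using that by (auto simp: vpath_def vwalk_def)
    ultimately consider "q = [hd q]" | "q = [hd q, last q]"
      by (cases q; cases "tl q") auto
    then show False
      using that \<open>x \<noteq> z\<close> \<open>(x, z) \<notin> parcs G\<close>
      by cases (metis last.simps, metis vpath_def vwalk_def vwalk_arcs.simps(3) list.set_intros(1)
          subsetD with_proj_simps(3))
  qed
  then have "shortest_vpath [x, y, z] G"
    using path by (simp add: shortest_vpath_def numeral_2_eq_2)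
  moreover have "card (S \<inter> set [x, y, z]) = 3"
  proof -
    have "S \<inter> set [x, y, z] = set [x, y, z]" using S by auto
    then show ?thesis using distinct_card[OF distinct] by simp
  qed
  ultimately show False
    using assms by (auto simp: general_position_def)
qed

text \<open>The universal vertex \<open>c\<close> bounds all distances by 2. A shortest path with
  three vertices in \<open>S\<close> therefore has no further vertices and is an induced path inside
  \<open>S\<close>.\<close>

lemma (in pair_graph) p3_free_imp_general_position:
  assumes "S \<subseteq> pverts G" "p3_free G S"
    and "c \<in> pverts G" and universal: "\<And>x. x \<in> pverts G \<Longrightarrow> x \<noteq> c \<Longrightarrow> (c, x) \<in> parcs G"
  shows "general_position G S"
  unfolding general_position_def
proof (intro conjI allI impI notI)
  fix p assume p: "shortest_vpath p G" and card: "3 \<le> card (S \<inter> set p)"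
  have path: "vpath p (with_proj G)"
    and short: "\<And>q. vpath q (with_proj G) \<Longrightarrow> hd q = hd p \<Longrightarrow> last q = last p \<Longrightarrow> length p - 1 \<le> length q - 1"
    using p by (auto simp: shortest_vpath_def)
  have ne: "p \<noteq> []" and sub: "set p \<subseteq> pverts G"
    using path by (auto simp: vpath_def vwalk_def)
  have ends: "hd p \<in> pverts G" "last p \<in> pverts G"
    using ne sub by auto
  have "length p \<ge> 3"
    using card card_mono[of "set p" "S \<inter> set p"] card_length[of p] by simp
  \<comment> \<open>The path \<open>p\<close> is compared with three shorter candidates in turn: the
    trivial path, the single arc between the ends, and the detour through \<open>c\<close>.\<close>
  have ends_ne: "hd p \<noteq> last p"
    using short[of "[hd p]"] ends \<open>length p \<ge> 3\<close> by (auto simp: vpath_def vwalk_def)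
  have ends_non_adj: "(hd p, last p) \<notin> parcs G"
    using short[of "[hd p, last p]"] ends ends_ne \<open>length p \<ge> 3\<close> by (auto simp: vpath_def vwalk_def)
  have "hd p \<noteq> c" "last p \<noteq> c"
    using ends ends_ne ends_non_adj universal arcs_symmetric by metis+
  then have "length p \<le> 3"
    using short[of "[hd p, c, last p]"] ends ends_ne universal arcs_symmetric \<open>c \<in> pverts G\<close>
    by (auto simp: vpath_def vwalk_def)
  with \<open>length p \<ge> 3\<close> obtain x y z where xyz: "p = [x, y, z]"
    by (auto simp: numeral_3_eq_3 length_Suc_conv le_antisym dest!: le_antisym)
  have "S \<inter> set p = set p"
    using card card_length[of p] by (intro card_seteq) (auto simp: xyz)
  then have "{x, y, z} \<subseteq> S" by (auto simp: xyz)
  moreover have "(x, y) \<in> parcs G" "(y, z) \<in> parcs G"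
    using path by (auto simp: xyz vpath_def vwalk_def)
  ultimately show False
    using \<open>p3_free G S\<close> ends_ne ends_non_adj by (auto simp: p3_free_def xyz)
qed (fact assms)

lemma (in pair_graph) general_position_finite: "finite {S. general_position G S}"
  by (rule finite_subset[of _ "Pow (pverts G)"])
    (auto simp: general_position_def)

lemma (in pair_graph) general_position_extends_to_maximal:
  assumes "general_position G S"
  obtains T where "maximal_general_position G T" "S \<subseteq> T"
proof -
  obtain T where "general_position G T" "S \<subseteq> T"
    and "\<forall>U\<in>{S. general_position G S}. T \<subseteq> U \<longrightarrow> T = U"
    using finite_has_maximal2[OF general_position_finite, of S] assms by blast
  then show thesis
    by (intro that) (auto simp: maximal_general_position_def)
qed

lemma (in pair_graph) maximal_general_position_finite: "finite {S. maximal_general_position G S}"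
  by (rule finite_subset[OF _ general_position_finite]) (auto simp: maximal_general_position_def)

lemma (in pair_graph) gp_minus_le:
  "maximal_general_position G S \<Longrightarrow> gp_minus G \<le> card S"
  unfolding gp_minus_def using maximal_general_position_finite by (intro Min_le) auto

lemma (in pair_graph) general_position_pair:
  assumes "u \<in> pverts G" "v \<in> pverts G"
  shows "general_position G {u, v}"
proof -
  have "card ({u, v} \<inter> X) \<le> 2" for X
    by (rule order_trans[OF card_mono[of "{u, v}"]]) (auto simp: card_insert_if)
  then have "\<not> 3 \<le> card ({u, v} \<inter> X)" for X
    by (metis Suc_n_not_le_n eval_nat_numeral(3) order_trans)
  then show ?thesis
    using assms by (simp add: general_position_def)
qed

section \<open>Counting the non-edges of a general position set\<close>

text \<open>Each \<open>w\<close> is charged to a non-edge at \<open>u\<close> if possible and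
  otherwise to one at \<open>v\<close>; the pair \<open>{u, v}\<close> itself is charged to
  \<open>v\<close>.\<close>

lemma (in pair_graph) p3_free_non_edges:
  fixes u v :: 'a and S :: "'a set"
  defines "f \<equiv> \<lambda>w. if (u, w) \<in> parcs G then {v, w} else {u, w}"
  assumes "p3_free G S" "S \<subseteq> pverts G" "u \<in> S" "v \<in> S" "u \<noteq> v" "(u, v) \<notin> parcs G"
  shows "inj_on f (S - {u})" "f ` (S - {u}) \<subseteq> non_edges G"
proof -
  show "inj_on f (S - {u})"
    \<comment> \<open>A coincidence \<open>{v, w} = {u, w'}\<close> would force
      \<open>w = u\<close>, which the domain excludes.\<close>
    using \<open>u \<noteq> v\<close> by (auto simp: inj_on_def f_def doubleton_eq_iff split: if_splits)
  show "f ` (S - {u}) \<subseteq> non_edges G"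
  proof (rule image_subsetI)
    fix w assume w: "w \<in> S - {u}"
    \<comment> \<open>Otherwise u - w - v would be an induced path in \<open>S\<close>.\<close>
    then have "(v, w) \<notin> parcs G" if "(u, w) \<in> parcs G"
      using assms that arcs_symmetric unfolding p3_free_def by blast
    moreover have "w \<noteq> v" if "(u, w) \<in> parcs G"
      using assms that by blast
    ultimately show "f w \<in> non_edges G"
      using w assms by (auto simp: f_def insert_in_non_edges_iff)
  qed
qed

lemma (in pair_graph) p3_free_card_le:
  assumes "p3_free G S" "S \<subseteq> pverts G" "u \<in> S" "v \<in> S" "u \<noteq> v" "(u, v) \<notin> parcs G"
  shows "card S \<le> card (non_edges G) + 1"
proof -
  have "card (S - {u}) \<le> card (non_edges G)"
    using card_inj_on_le[OF p3_free_non_edges[OF assms] finite_non_edges] .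
  then show ?thesis using \<open>u \<in> S\<close> by (simp add: card_Diff_singleton_if)
qed

text \<open>Equality makes the charging map a bijection onto all non-edges, so every non-edge meets
  \<open>u\<close> or \<open>v\<close>. The centre is \<open>u\<close> if \<open>u\<close> has no
  neighbour in \<open>S\<close>, and \<open>v\<close> otherwise.\<close>

lemma (in pair_graph) p3_free_card_eq_imp_star:
  assumes "p3_free G S" "S \<subseteq> pverts G" "u \<in> S" "v \<in> S" "u \<noteq> v" "(u, v) \<notin> parcs G"
    and card: "card S = card (non_edges G) + 1"
  obtains c where "c \<in> S" "non_edges G = (\<lambda>i. {c, i}) ` (S - {c})"
proof -
  let ?f = "\<lambda>w. if (u, w) \<in> parcs G then {v, w} else {u, w}"
  note f = p3_free_non_edges[OF assms(1-6)]
  have "card (?f ` (S - {u})) = card (non_edges G)"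
    using card card_image[OF f(1)] \<open>u \<in> S\<close> by (simp add: card_Diff_singleton_if)
  then have all: "non_edges G = ?f ` (S - {u})"
    using card_subset_eq[OF finite_non_edges f(2)] by simp
  show thesis
  proof (cases "\<exists>b\<in>S. (u, b) \<in> parcs G")
    case False
    then show thesis
      using all \<open>u \<in> S\<close> by (intro that[of u]) (auto simp: image_iff)
  next
    case True
    then obtain b where b: "b \<in> S" "(u, b) \<in> parcs G" by blast
    have adj: "(u, a) \<in> parcs G" if a: "a \<in> S" "a \<noteq> u" "a \<noteq> v" for a
    proof (rule ccontr)
      assume na: "(u, a) \<notin> parcs G"
      have "b \<noteq> u" "b \<noteq> v" "a \<noteq> b"
        using b na no_loops' \<open>(u, v) \<notin> parcs G\<close> by auto
      \<comment> \<open>Every value of \<open>?f\<close> contains \<open>u\<close> or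
        \<open>v\<close>, and \<open>a\<close>, \<open>b\<close> differ from both. Hence
        \<open>a\<close> and \<open>b\<close> are adjacent, and u - b - a is an induced
        path.\<close>
      then have "{a, b} \<notin> non_edges G"
        using a by (auto simp: all doubleton_eq_iff)
      then have "(a, b) \<in> parcs G"
        using a b \<open>a \<noteq> b\<close> \<open>S \<subseteq> pverts G\<close> by (auto simp: insert_in_non_edges_iff)
      then show False
        using \<open>p3_free G S\<close> a b na \<open>u \<in> S\<close> arcs_symmetric unfolding p3_free_def by blast
    qed
    have "S - {u} = insert v (S - {u} - {v})"
      using \<open>v \<in> S\<close> \<open>u \<noteq> v\<close> by auto
    then have "?f ` (S - {u}) = ?f ` insert v (S - {u} - {v})"
      by (rule arg_cong)
    also have "\<dots> = insert (?f v) (?f ` (S - {u} - {v}))"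
      by (rule image_insert)
    also have "?f v = {v, u}" using \<open>(u, v) \<notin> parcs G\<close> by auto
    also have "?f ` (S - {u} - {v}) = (\<lambda>i. {v, i}) ` (S - {u} - {v})"
      using adj by (intro image_cong) auto
    \<comment> \<open>The extra pair is the value at \<open>i = u\<close>.\<close>
    also have "insert {v, u} \<dots> = (\<lambda>i. {v, i}) ` (S - {v})"
      using \<open>u \<in> S\<close> \<open>u \<noteq> v\<close> by auto
    finally show thesis
      using all \<open>v \<in> S\<close> by (intro that[of v]) simp_all
  qed
qed

section \<open>The extremal graph\<close>

lemma pverts_extremal_graph [simp]: "pverts (extremal_graph n k) = {..<n}"
  by (simp add: extremal_graph_def delete_edges_def complete_graph_def)

lemma parcs_extremal_graph:
  "(x, y) \<in> parcs (extremal_graph n k) \<longleftrightarrow>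
     x < n \<and> y < n \<and> x \<noteq> y \<and> {x, y} \<notin> (\<lambda>i. {0, i}) ` {1..<k}"
  by (auto simp: extremal_graph_def delete_edges_def complete_graph_def)

lemma parcs_extremal_graph':
  "(x, y) \<in> parcs (extremal_graph n k) \<longleftrightarrow>
     x < n \<and> y < n \<and> x \<noteq> y \<and> (x = 0 \<longrightarrow> k \<le> y) \<and> (y = 0 \<longrightarrow> k \<le> x)"
  unfolding parcs_extremal_graph by (auto simp: doubleton_eq_iff image_iff)

lemma pair_graph_extremal_graph: "pair_graph (extremal_graph n k)"
proof
  show "finite (parcs (extremal_graph n k))"
    by (rule finite_subset[of _ "{..<n} \<times> {..<n}"]) (auto simp: parcs_extremal_graph')
  show "symmetric (with_proj (extremal_graph n k))"
    by (auto simp: symmetric_def parcs_extremal_graph' intro!: symI)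
qed (auto simp: parcs_extremal_graph')

lemma non_edges_extremal_graph:
  assumes "k \<le> n"
  shows "non_edges (extremal_graph n k) = (\<lambda>i. {0, i}) ` {1..<k}"
  using assms unfolding non_edges_def parcs_extremal_graph
  by (fastforce simp: doubleton_eq_iff)

lemma num_edges_extremal_graph:
  assumes "k \<le> n"
  shows "num_edges (extremal_graph n k) + (k - 1) = n choose 2"
proof -
  have "card (non_edges (extremal_graph n k)) = k - 1"
    unfolding non_edges_extremal_graph[OF assms]
    by (subst card_image) (auto simp: inj_on_def doubleton_eq_iff)
  then show ?thesis
    using pair_graph.num_edges_plus_card_non_edges[OF pair_graph_extremal_graph, of n k]
    by (simp add: num_verts_def)
qed

text \<open>As \<open>k < n\<close>, the vertex \<open>n - 1\<close> loses no edge, so it serves as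
  a hub.\<close>

lemma connected_extremal_graph:
  assumes "k < n"
  shows "connected (extremal_graph n k)"
proof -
  interpret pair_graph "extremal_graph n k" by (rule pair_graph_extremal_graph)
  have arc: "(u, n - 1) \<in> parcs (extremal_graph n k)" if "u < n - 1" for u
    using assms that by (auto simp: parcs_extremal_graph')
  have to_hub: "u \<rightarrow>\<^sup>*\<^bsub>with_proj (extremal_graph n k)\<^esub> (n - 1)" if "u < n" for u
    using assms that arc[of u] by (cases "u = n - 1") auto
  have from_hub: "(n - 1) \<rightarrow>\<^sup>*\<^bsub>with_proj (extremal_graph n k)\<^esub> u" if "u < n" for u
    using assms that arcs_symmetric[OF arc[of u]] by (cases "u = n - 1") auto
  show ?thesis
    unfolding connected_def strongly_connected_def
    using assms to_hub from_hub reachable_trans by (auto intro!: reachable_mk_symmetricI) blast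
qed

text \<open>The induced paths are 0 - w - i with 1 \<le> i < k \<le> w < n. A general position set
  must miss one of the three vertex classes entirely, which leaves three candidates for a maximal
  one.\<close>

lemma gp_minus_extremal_graph:
  assumes "2 \<le> k" "2 * k - 1 \<le> n"
  shows "gp_minus (extremal_graph n k) = k"
proof -
  let ?G = "extremal_graph n k"
  interpret pair_graph ?G by (rule pair_graph_extremal_graph)
  have gpI: "general_position ?G S" if "S \<subseteq> {..<n}" "p3_free ?G S" for S
    by (rule p3_free_imp_general_position[of _ "n - 1"])
      (use assms that in \<open>auto simp: parcs_extremal_graph'\<close>)
  have gp: "general_position ?G {..<k}" "general_position ?G {1..<n}"
    "general_position ?G (insert 0 {k..<n})"
    using assms by (auto intro!: gpI simp: p3_free_def parcs_extremal_graph')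
  have cover: "S \<subseteq> {..<k} \<or> S \<subseteq> {1..<n} \<or> S \<subseteq> insert 0 {k..<n}" if "general_position ?G S" for S
  proof (rule ccontr)
    assume "\<not> ?thesis"
    then obtain a i w where outside: "a \<in> S" "a \<notin> {1..<n}" "i \<in> S" "i \<notin> insert 0 {k..<n}"
      "w \<in> S" "w \<notin> {..<k}" by blast
    moreover have "S \<subseteq> {..<n}" using that by (simp add: general_position_def)
    ultimately have "a < n" "i < n" "w < n" by blast+
    \<comment> \<open>Failing the three inclusions yields a witness in each class: \<open>a\<close>
      must be 0, \<open>i\<close> lies strictly between 0 and \<open>k\<close>, and \<open>w\<close>
      is at least \<open>k\<close>.\<close>
    with outside have in_S: "0 \<in> S" "w \<in> S" "i \<in> S" and "0 < i" "i < k" "k \<le> w" "w < n"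
      by (auto simp: not_le)
    then have "(0, w) \<in> parcs ?G" "(w, i) \<in> parcs ?G" "(0, i) \<notin> parcs ?G"
      by (auto simp: parcs_extremal_graph')
    then show False
      using p3_freeD[OF general_position_imp_p3_free[OF that] in_S] \<open>0 < i\<close> by simp
  qed
  have ge: "k \<le> card S" if "maximal_general_position ?G S" for S
  proof -
    have "S = {..<k} \<or> S = {1..<n} \<or> S = insert 0 {k..<n}"
      using that cover[of S] gp unfolding maximal_general_position_def by blast
    \<comment> \<open>The sizes are \<open>k\<close>, \<open>n - 1\<close> and
      \<open>n - k + 1\<close>; the last is at least \<open>k\<close> exactly because
      \<open>2 * k - 1\<close> is at most \<open>n\<close>.\<close>
    then show ?thesis using assms by auto
  qed
  have "maximal_general_position ?G {..<k}"
    unfolding maximal_general_position_def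
  proof (intro conjI notI, fact gp(1), elim exE conjE)
    fix T assume T: "general_position ?G T" "{..<k} \<subset> T"
    have "0 \<in> {..<k}" "1 \<in> {..<k}" using assms by auto
    with T(2) have "0 \<in> T" "1 \<in> T" by blast+
    \<comment> \<open>Containing 0 rules out the second candidate, and containing 1 rules out the
      third since \<open>k\<close> is at least 2.\<close>
    with assms have "\<not> T \<subseteq> {1..<n}" "\<not> T \<subseteq> insert 0 {k..<n}" by force+
    with cover[OF T(1)] T(2) show False by blast
  qed
  then show ?thesis
    unfolding gp_minus_def
    using ge maximal_general_position_finite
    by (intro Min_eqI) (auto simp: image_iff intro!: exI[of _ "{..<k}"])
qed

section \<open>Recognising the extremal graph and deriving the bound\<close>

lemma (in pair_graph) star_non_edges_imp_iso_extremal_graph: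
  assumes "c \<in> S" "S \<subseteq> pverts G" and non_edges: "non_edges G = (\<lambda>i. {c, i}) ` (S - {c})"
  shows "digraph_iso G (extremal_graph (num_verts G) (card S))"
proof -
  let ?n = "num_verts G" and ?k = "card S"
  have fin: "finite S" "finite (pverts G)"
    using assms pair_finite_verts by (auto intro: finite_subset)
  have "?k \<noteq> 0" using \<open>c \<in> S\<close> fin by auto
  then have "?k \<ge> 1" by simp
  have "?k \<le> ?n" unfolding num_verts_def using assms fin card_mono by blast
  obtain g where g: "bij_betw g (S - {c}) {1..<?k}"
    using finite_same_card_bij[of "S - {c}" "{1..<?k}"] fin \<open>c \<in> S\<close> by (auto simp: card_Diff_singleton_if)
  obtain h where h: "bij_betw h (pverts G - S) {?k..<?n}"
    using finite_same_card_bij[of "pverts G - S" "{?k..<?n}"] fin assms(2)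
    by (auto simp: card_Diff_subset num_verts_def)
  \<comment> \<open>The centre goes to 0, the ends of its missing edges to 1, ...,
    \<open>card S - 1\<close>, and the remaining vertices, which lose no edge, to the rest.\<close>
  define f where "f x = (if x = c then 0 else if x \<in> S then g x else h x)" for x
  have "bij_betw f {c} {0}" by (simp add: f_def bij_betw_def)
  moreover have fg: "bij_betw f (S - {c}) {1..<?k}"
    using g by (rule bij_betw_cong[THEN iffD1, rotated]) (auto simp: f_def)
  moreover have "bij_betw f (pverts G - S) {?k..<?n}"
    using h by (rule bij_betw_cong[THEN iffD1, rotated]) (use \<open>c \<in> S\<close> in \<open>auto simp: f_def\<close>)
  ultimately have "bij_betw f ({c} \<union> (S - {c}) \<union> (pverts G - S)) ({0} \<union> {1..<?k} \<union> {?k..<?n})"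
    using \<open>?k \<ge> 1\<close> by (intro bij_betw_combine) auto
  moreover have "{c} \<union> (S - {c}) \<union> (pverts G - S) = pverts G" using assms by auto
  moreover have "{0} \<union> {1..<?k} \<union> {?k..<?n} = {..<?n}"
    using \<open>?k \<ge> 1\<close> \<open>?k \<le> ?n\<close> by auto
  ultimately have f: "bij_betw f (pverts G) {..<?n}" by simp
  have inj: "inj_on f (pverts G)" and im: "f ` pverts G = {..<?n}"
    using f by (auto simp: bij_betw_def)
  \<comment> \<open>Both graphs are determined by their missing pairs, so it suffices that
    \<open>f\<close> carries the star of non-edges onto the deleted star.\<close>
  have "{f x, f y} \<in> (\<lambda>i. {0, i}) ` {1..<?k} \<longleftrightarrow> {x, y} \<in> non_edges G"
    if "x \<in> pverts G" "y \<in> pverts G" for x y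
  proof -
    have "(\<lambda>i. {0, i}) ` {1..<?k} = (\<lambda>i. {0, i}) ` f ` (S - {c})"
      using fg by (simp add: bij_betw_def)
    also have "\<dots> = image f ` non_edges G"
      by (simp add: non_edges image_image) (simp add: f_def)
    finally have eq: "(\<lambda>i. {0, i}) ` {1..<?k} = image f ` non_edges G" .
    have "f ` {x, y} \<in> image f ` non_edges G \<longleftrightarrow> {x, y} \<in> non_edges G"
      by (rule inj_on_image_mem_iff[OF inj_on_image_Pow[OF inj]])
        (use that in \<open>auto simp: non_edges_def\<close>)
    then show ?thesis unfolding eq by simp
  qed
  then have arc: "(f x, f y) \<in> parcs (extremal_graph ?n ?k) \<longleftrightarrow> (x, y) \<in> parcs G"
    if "x \<in> pverts G" "y \<in> pverts G" for x y
    using that im inj unfolding parcs_extremal_graph in_parcs_iff_non_edges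
    by (auto simp: inj_on_eq_iff)
  have arcs: "parcs (extremal_graph ?n ?k) = map_prod f f ` parcs G"
  proof (intro equalityI subsetI)
    fix a assume a: "a \<in> parcs (extremal_graph ?n ?k)"
    then have "fst a \<in> f ` pverts G" "snd a \<in> f ` pverts G"
      unfolding im by (cases a, auto simp: parcs_extremal_graph)+
    then obtain x y where "x \<in> pverts G" "y \<in> pverts G" "a = (f x, f y)"
      by (metis imageE prod.collapse)
    then show "a \<in> map_prod f f ` parcs G" using arc a by force
  next
    fix a assume "a \<in> map_prod f f ` parcs G"
    then show "a \<in> parcs (extremal_graph ?n ?k)" using arc in_arcsD1 in_arcsD2 by force
  qed
  define hom where
    \<comment> \<open>Taking \<open>fst\<close> and \<open>snd\<close> for the new tail and head
      makes the image under \<open>app_iso\<close> a \<open>with_proj\<close> graph again.\<close>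
    "hom = \<lparr>iso_verts = f, iso_arcs = map_prod f f, iso_head = snd, iso_tail = fst\<rparr>"
  have "inj_on (map_prod f f) (parcs G)"
    by (rule inj_on_subset[OF map_prod_inj_on[OF inj inj]]) (auto dest: in_arcsD1 in_arcsD2)
  then have "digraph_isomorphism hom"
    using inj wf_digraph_axioms by (simp add: digraph_isomorphism_def hom_def)
  moreover have "with_proj (extremal_graph ?n ?k) = app_iso hom (with_proj G)"
    by (simp add: with_proj_def app_iso_def hom_def arcs im)
  ultimately show ?thesis
    unfolding digraph_iso_def by blast
qed

lemma (in pair_graph) non_edges_lower_bound:
  assumes "2 \<le> gp_minus G" "2 * gp_minus G - 1 \<le> num_verts G"
  shows "gp_minus G \<le> card (non_edges G) + 1"
    and "gp_minus G = card (non_edges G) + 1 \<Longrightarrow>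
      digraph_iso G (extremal_graph (num_verts G) (gp_minus G))"
proof -
  have "\<exists>u\<in>pverts G. \<exists>v\<in>pverts G. u \<noteq> v \<and> (u, v) \<notin> parcs G"
  proof (rule ccontr)
    assume "\<not> ?thesis"
    then have complete: "\<And>u v. u \<in> pverts G \<Longrightarrow> v \<in> pverts G \<Longrightarrow> u \<noteq> v \<Longrightarrow> (u, v) \<in> parcs G"
      by blast
    have "card (pverts G) \<noteq> 0" using assms by (auto simp: num_verts_def)
    then obtain c where c: "c \<in> pverts G" by fastforce
    have gp: "general_position G S" if "S \<subseteq> pverts G" for S
      using that complete c
      by (intro p3_free_imp_general_position[OF _ _ c]) (auto simp: p3_free_def subset_iff)
    have "maximal_general_position G S \<longleftrightarrow> S = pverts G" for S
      using gp unfolding maximal_general_position_def by (auto simp: general_position_def)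
    then have "gp_minus G = num_verts G"
      by (simp add: gp_minus_def num_verts_def)
    \<comment> \<open>With \<open>gp_minus G\<close> equal to the order n, the hypotheses would give
      both 2 \<le> n and 2 n - 1 \<le> n.\<close>
    then show False using assms by simp
  qed
  then obtain u v where uv: "u \<in> pverts G" "v \<in> pverts G" "u \<noteq> v" "(u, v) \<notin> parcs G"
    by blast
  obtain S where S: "maximal_general_position G S" "{u, v} \<subseteq> S"
    using general_position_extends_to_maximal[OF general_position_pair[OF uv(1,2)]] .
  have free: "p3_free G S" "S \<subseteq> pverts G" "u \<in> S" "v \<in> S" "u \<noteq> v" "(u, v) \<notin> parcs G"
    using S uv general_position_imp_p3_free
    by (auto simp: maximal_general_position_def general_position_def)
  note le = gp_minus_le[OF S(1)] p3_free_card_le[OF free]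
  then show "gp_minus G \<le> card (non_edges G) + 1" by simp
  assume eq: "gp_minus G = card (non_edges G) + 1"
  \<comment> \<open>The size of \<open>S\<close> is squeezed between \<open>gp_minus G\<close> and
    \<open>card (non_edges G) + 1\<close>.\<close>
  with le have card: "card S = card (non_edges G) + 1" by simp
  show "digraph_iso G (extremal_graph (num_verts G) (gp_minus G))"
    using p3_free_card_eq_imp_star[OF free card] star_non_edges_imp_iso_extremal_graph[OF _ free(2)]
    by (metis eq card)
qed

theorem theorem3p5:
  fixes n k :: nat
  assumes "2 \<le> k" and "2 * k - 1 \<le> n"
  shows "(\<forall>G :: 'a pair_pre_digraph.
        pair_graph G \<and> connected G \<and> num_verts G = n \<and> gp_minus G = k \<longrightarrow>
          int (num_edges G) \<le> int (n choose 2) - int k + 1 \<and>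
          (int (num_edges G) = int (n choose 2) - int k + 1 \<longleftrightarrow>
             digraph_iso G (extremal_graph n k))) \<and>
      (pair_graph (extremal_graph n k) \<and> connected (extremal_graph n k) \<and>
        num_verts (extremal_graph n k) = n \<and> gp_minus (extremal_graph n k) = k \<and>
        int (num_edges (extremal_graph n k)) = int (n choose 2) - int k + 1)"
proof -
  have "k < n" using assms by simp
  then have "num_edges (extremal_graph n k) + (k - 1) = n choose 2"
    by (intro num_edges_extremal_graph) simp
  then have extremal: "int (num_edges (extremal_graph n k)) = int (n choose 2) - int k + 1"
    using assms by linarith
  have "int (num_edges G) \<le> int (n choose 2) - int k + 1 \<and>
      (int (num_edges G) = int (n choose 2) - int k + 1 \<longleftrightarrow> digraph_iso G (extremal_graph n k))"
    if "pair_graph G" "num_verts G = n" "gp_minus G = k" for G :: "'a pair_pre_digraph"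
  proof -
    interpret pair_graph G by fact
    have sum: "num_edges G + card (non_edges G) = n choose 2"
      using num_edges_plus_card_non_edges that by simp
    have le: "k \<le> card (non_edges G) + 1"
      and iso: "k = card (non_edges G) + 1 \<Longrightarrow> digraph_iso G (extremal_graph n k)"
      using non_edges_lower_bound that assms by simp_all
    have "digraph_iso G (extremal_graph n k)" if "int (num_edges G) = int (n choose 2) - int k + 1"
      using that sum le by (intro iso) linarith
    then show ?thesis
      using sum le extremal digraph_iso_num_edges[of G "extremal_graph n k"] by force
  qed
  then show ?thesis
    using extremal pair_graph_extremal_graph connected_extremal_graph[OF \<open>k < n\<close>]
      gp_minus_extremal_graph[OF assms]
    by (simp add: num_verts_def)
qed

end
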